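(* Let $\mathcal H$ be a real Hilbert space, $T_\Gamma:\mathcal H\to\mathcal H$ a non-expansive operator, $(T_{\Gamma_k})_{k\in\mathbb N}$ operators from $\mathcal H$ to $\mathcal H$, $\varepsilon_k\in\mathcal H$, and let $(z_k)_{k\in\mathbb N}$ be generated from $z_0\in\mathcal H$ by the non-stationary iteration $z_{k+1}=z_k+\lambda_k(T_{\Gamma_k}z_k+\varepsilon_k-z_k)$. Assume: (A.1) $\mathrm{fix}\,T_\Gamma\ne\emptyset$; (A.2) for all $k\in\mathbb N$, $T_{\Gamma_k,\lambda_k}=\lambda_kT_{\Gamma_k}+(1-\lambda_k)\mathrm{Id}$ is $(1+\beta_k)$-Lipschitz with $\beta_k\ge0$, and $\sum_k\beta_k<+\infty$; (A.3) $\lambda_k\in(0,1)$ and $\inf_{k\in\mathbb N}\lambda_k(1-\lambda_k)>0$; (A.4) $\sum_k\lambda_k\|\varepsilon_k\|<+\infty$; (A.5) for all $\rho\in[0,+\infty)$, $\sum_k\lambda_k\Delta_{k,\rho}<+\infty$, where $\Delta_{k,\rho}=\sup_{\|z\|\le\rho}\|T_{\Gamma_k}z-T_\Gamma z\|$. Then $(e_k)_{k\in\mathbb N}$ converges strongly to $0$, and $(z_k)_{k\in\mathbb N}$ converges weakly to a point $z^\star\in\mathrm{fix}\,T_\Gamma$.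
   Context: $\mathrm{fix}\,T=\{z:z=Tz\}$. With $\pi_k=(T_{\Gamma_k}-T_\Gamma)z_k+\varepsilon_k$, one sets $e_k=(z_k-z_{k+1})/\lambda_k+\pi_k$, i.e. $e_k=(\mathrm{Id}-T_\Gamma)z_k$. $\mathbb N$ is the set of non-negative integers. *)

theory Defs
  imports "HOL-Analysis.Analysis"
begin

definition fixed_points :: "('a \<Rightarrow> 'a) \<Rightarrow> 'a set" where
  "fixed_points T = {z. z = T z}"

definition relaxed_op :: "real \<Rightarrow> ('a::real_vector \<Rightarrow> 'a) \<Rightarrow> 'a \<Rightarrow> 'a" where
  "relaxed_op l T z = l *\<^sub>R T z + (1 - l) *\<^sub>R z"

(* The supremum is taken in [0, \<infinity>]: over the reals, SUP would return an
   unspecified value when the operators differ unboundedly on the ball. *)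
definition ball_deviation :: "('a::real_normed_vector \<Rightarrow> 'a) \<Rightarrow> ('a \<Rightarrow> 'a) \<Rightarrow> real \<Rightarrow> ennreal" where
  "ball_deviation S T \<rho> = (SUP z\<in>{z. norm z \<le> \<rho>}. ennreal (norm (S z - T z)))"

(* Sequential convergence in the weak topology of an inner product space,
   i.e. the topology generated by the functionals z \<mapsto> z \<bullet> u. *)
definition weakly_converges_to :: "(nat \<Rightarrow> 'a::real_inner) \<Rightarrow> 'a \<Rightarrow> bool" where
  "weakly_converges_to z l \<longleftrightarrow> (\<forall>u. (\<lambda>k. z k \<bullet> u) \<longlonglongrightarrow> l \<bullet> u)"

end

theory Submission
  imports Defs
begin

text \<open>
  Write \<open>R\<^sub>k\<close> for the relaxation of \<open>T\<^sub>k\<close>, so that the iteration reads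
  \<open>z\<^sub>k\<^sub>+\<^sub>1 = R\<^sub>k z\<^sub>k + \<lambda>\<^sub>k \<epsilon>\<^sub>k\<close>, and let \<open>p\<close> be a fixed point of \<open>T\<close>. It is moved by \<open>R\<^sub>k\<close> only by
  \<open>\<lambda>\<^sub>k \<parallel>T\<^sub>k p - T p\<parallel>\<close>, which is summable because the deviations are
  summable on a ball around \<open>0\<close> that contains \<open>p\<close>. Hence \<open>\<parallel>z\<^sub>k - p\<parallel>\<close> grows at most by the factors
  \<open>1 + \<beta>\<^sub>k\<close> and by summable increments, and stays bounded.

  Once the iterates lie in a ball, the summability of the deviations on that ball and of the errors
  \<open>\<lambda>\<^sub>k \<parallel>\<epsilon>\<^sub>k\<parallel>\<close> makes \<open>\<lambda>\<^sub>k \<parallel>\<pi>\<^sub>k\<parallel>\<close> summable, and the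
  iteration is a summably perturbed iteration of the relaxations of the single operator \<open>T\<close>.
  For these the identity \<open>norm_convex_comb_sq\<close> gives a decrease of \<open>\<parallel>z\<^sub>k - p\<parallel>\<^sup>2\<close> by at least
  \<open>\<lambda>\<^sub>k (1 - \<lambda>\<^sub>k) \<parallel>e\<^sub>k\<parallel>\<^sup>2\<close>. Telescoping bounds \<open>\<Sum> \<parallel>e\<^sub>k\<parallel>\<^sup>2\<close>, so \<open>e\<^sub>k\<close> tends to \<open>0\<close>; moreover \<open>\<parallel>z\<^sub>k - q\<parallel>\<close>
  converges for every fixed point \<open>q\<close>.

  Weak convergence follows as in Opial's lemma, but asymptotic centres take the place of weak cluster
  points, so that weak compactness of balls and the Riesz representation theorem are avoided.
  The asymptotic radius of \<open>z\<close> about \<open>y\<close> is the upper limit of \<open>\<parallel>z\<^sub>k - y\<parallel>\<close>. Its square is strongly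
  convex in \<open>y\<close>, hence has a unique minimiser by completeness, the asymptotic centre. Subsequences
  are represented by proper filters \<open>F\<close> finer than \<open>sequentially\<close>. Three facts suffice
  (\<open>weakly_converges_to_fixed_point\<close>):
    \<^item> every centre is a fixed point, since \<open>T\<close> does not increase the asymptotic radius of an
      approximate fixed-point sequence;
    \<^item> the radius about a fixed point is a genuine limit, hence the same for all \<open>F\<close>, so all \<open>F\<close> have
      one common centre \<open>c\<close>;
    \<^item> if \<open>z\<^sub>k \<bullet> u\<close> did not tend to \<open>c \<bullet> u\<close>, then along some \<open>F\<close> the sequence would stay on one side of
      a hyperplane that misses \<open>c\<close>, and moving \<open>c\<close> towards that side would reduce the radius.
\<close>

section \<open>Real sequences\<close>

text \<open>
  Unrolling the recursion bounds \<open>a\<^sub>n\<close> by \<open>\<Prod> (1 + \<beta>\<^sub>k) \<cdot> (a\<^sub>0 + \<Sum> s\<^sub>k)\<close>, and \<open>1 + \<beta>\<^sub>k \<le> exp \<beta>\<^sub>k\<close> turns the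
  product into the exponential of a convergent sum.
\<close>

lemma perturbed_contraction_bounded:
  fixes a \<beta> s :: "nat \<Rightarrow> real"
  assumes step: "\<And>k. a (Suc k) \<le> (1 + \<beta> k) * a k + s k"
    and "\<And>k. 0 \<le> a k" "\<And>k. 0 \<le> \<beta> k" "\<And>k. 0 \<le> s k"
    and "summable \<beta>" "summable s"
  obtains B where "\<And>k. a k \<le> B"
proof -
  have *: "a n \<le> exp (\<Sum>k<n. \<beta> k) * (a 0 + (\<Sum>k<n. s k))" for n
  proof (induction n)
    case (Suc n)
    let ?E = "exp (\<Sum>k<n. \<beta> k)" and ?E' = "exp (\<Sum>k<Suc n. \<beta> k)"
    let ?S = "a 0 + (\<Sum>k<n. s k)"
    have "0 \<le> (\<Sum>k<n. s k)" "0 \<le> (\<Sum>k<Suc n. \<beta> k)"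
      using assms by (auto intro!: sum_nonneg simp del: sum.lessThan_Suc)
    then have "0 \<le> ?S" "1 \<le> ?E'"
      using assms(2)[of 0] by (auto simp: one_le_exp_iff)
    have "(1 + \<beta> n) * a n \<le> exp (\<beta> n) * (?E * ?S)"
      by (rule mult_mono) (use Suc assms exp_ge_add_one_self in \<open>auto\<close>)
    also have "\<dots> = ?E' * ?S"
      by (simp add: exp_add)
    finally have "a (Suc n) \<le> ?E' * ?S + s n"
      using step[of n] by linarith
    also have "s n \<le> ?E' * s n"
      using \<open>1 \<le> ?E'\<close> assms(4)[of n] by (simp add: mult_le_cancel_right1)
    finally show ?case
      by (simp add: algebra_simps)
  qed simp
  show thesis
  proof
    fix n
    have "exp (\<Sum>k<n. \<beta> k) * (a 0 + (\<Sum>k<n. s k)) \<le> exp (suminf \<beta>) * (a 0 + suminf s)"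
      using assms by (intro mult_mono add_mono sum_le_suminf add_nonneg_nonneg sum_nonneg)
        (auto intro!: sum_le_suminf)
    with * show "a n \<le> exp (suminf \<beta>) * (a 0 + suminf s)"
      using order_trans by blast
  qed
qed

text \<open>
  Subtracting the partial sums of \<open>s\<close> leaves a decreasing sequence that is bounded below.
\<close>

lemma summably_increasing_convergent:
  fixes a s :: "nat \<Rightarrow> real"
  assumes step: "\<And>k. a (Suc k) \<le> a k + s k"
    and "\<And>k. 0 \<le> a k" "\<And>k. 0 \<le> s k" "summable s"
  shows "convergent a"
proof -
  define b where "b n = a n - (\<Sum>k<n. s k)" for n
  have "decseq b"
    unfolding decseq_Suc_iff b_def using step by (simp add: algebra_simps)
  moreover have "- suminf s \<le> b n" for n
    using assms(2)[of n] sum_le_suminf[OF assms(4), of "{..<n}"] assms(3) by (simp add: b_def)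
  ultimately obtain l where "b \<longlonglongrightarrow> l"
    using decseq_convergent by blast
  then have "(\<lambda>n. b n + (\<Sum>k<n. s k)) \<longlonglongrightarrow> l + suminf s"
    using assms(4) by (intro tendsto_add summable_LIMSEQ)
  then show ?thesis
    by (auto simp: b_def convergent_def)
qed

lemma summable_of_decrease:
  fixes A q t :: "nat \<Rightarrow> real"
  assumes step: "\<And>k. A (Suc k) + q k \<le> A k + t k"
    and "\<And>k. 0 \<le> A k" "\<And>k. 0 \<le> q k" "\<And>k. 0 \<le> t k" "summable t"
  shows "summable q"
proof (rule summableI_nonneg_bounded)
  fix n
  have "A n + (\<Sum>k<n. q k) \<le> A 0 + (\<Sum>k<n. t k)"
  proof (induction n)
    case (Suc n)
    then show ?case using step[of n] by simp
  qed simp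
  moreover have "(\<Sum>k<n. t k) \<le> suminf t"
    using assms by (intro sum_le_suminf) auto
  ultimately show "(\<Sum>k<n. q k) \<le> A 0 + suminf t"
    using assms(2)[of n] by linarith
qed (use assms in auto)

section \<open>Asymptotic radius and asymptotic centre\<close>

text \<open>
  This identity provides both the strong convexity of the squared asymptotic radius (at \<open>t = 1/2\<close>) and
  the decrease of the distance to a fixed point in a relaxed step (at \<open>t = \<lambda>\<^sub>k\<close>).
\<close>

lemma norm_convex_comb_sq:
  fixes a b :: "'a::real_inner"
  shows "(norm ((1 - t) *\<^sub>R a + t *\<^sub>R b))\<^sup>2
       = (1 - t) * (norm a)\<^sup>2 + t * (norm b)\<^sup>2 - t * (1 - t) * (norm (a - b))\<^sup>2"
  unfolding power2_norm_eq_inner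
  by (simp add: inner_add_left inner_add_right inner_diff_left inner_diff_right inner_commute[of b a])
    algebra

lemma norm_diff_scaleR_sq:
  fixes v u :: "'a::real_inner"
  shows "(norm (v - t *\<^sub>R u))\<^sup>2 = (norm v)\<^sup>2 - 2 * t * (v \<bullet> u) + t * (t * (norm u)\<^sup>2)"
  unfolding power2_norm_eq_inner by (simp add: inner_simps inner_commute[of u v] algebra_simps)

text \<open>
  The midpoint of two almost-minimisers cannot go below the infimum, so the quadratic gain forces them
  close together: a minimising sequence is Cauchy, and its limit is the minimiser. The same
  estimate gives uniqueness.
\<close>

lemma strongly_midconvex_has_strict_minimum:
  fixes f :: "'a::{real_normed_vector, complete_space} \<Rightarrow> real"
  assumes mid: "\<And>x y. f ((1/2) *\<^sub>R (x + y)) \<le> (f x + f y) / 2 - (norm (x - y))\<^sup>2 / 4"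
    and nonneg: "\<And>x. 0 \<le> f x"
    and cont: "continuous_on UNIV f"
  obtains c where "\<And>y. y \<noteq> c \<Longrightarrow> f c < f y"
proof -
  define m where "m = Inf (range f)"
  have bdd: "bdd_below (range f)"
    using nonneg by (auto intro!: bdd_belowI)
  have m: "m \<le> f y" for y
    unfolding m_def using bdd by (intro cInf_lower) auto
  have close: "(norm (x - y))\<^sup>2 \<le> 2 * (f x - m) + 2 * (f y - m)" for x y
    using mid[of x y] m[of "(1/2) *\<^sub>R (x + y)"] by (simp add: field_simps)
  have "\<exists>y. f y < m + inverse (Suc n)" for n
    using cInf_lessD[of "range f" "m + inverse (Suc n)"] by (auto simp: m_def)
  then obtain y where y: "\<And>n. f (y n) < m + inverse (Suc n)"
    by metis
  have fy: "(\<lambda>n. f (y n)) \<longlonglongrightarrow> m"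
  proof (rule tendsto_sandwich[OF always_eventually always_eventually tendsto_const])
    show "(\<lambda>n. m + inverse (Suc n)) \<longlonglongrightarrow> m"
      using LIMSEQ_inverse_real_of_nat_add .
  qed (use y m less_imp_le in auto)
  have "Cauchy y"
  proof (rule metric_CauchyI)
    fix e :: real assume "0 < e"
    then have "\<forall>\<^sub>F n in sequentially. f (y n) < m + e\<^sup>2 / 4"
      by (intro order_tendstoD[OF fy]) simp
    then obtain N where N: "\<And>n. n \<ge> N \<Longrightarrow> f (y n) < m + e\<^sup>2 / 4"
      by (auto simp: eventually_sequentially)
    have "dist (y i) (y j) < e" if "i \<ge> N" "j \<ge> N" for i j
    proof -
      have "(dist (y i) (y j))\<^sup>2 < e\<^sup>2"
        using close[of "y i" "y j"] N[OF that(1)] N[OF that(2)] by (simp add: dist_norm)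
      then show ?thesis
        using \<open>0 < e\<close> by (simp add: power2_less_imp_less)
    qed
    then show "\<exists>M. \<forall>i\<ge>M. \<forall>j\<ge>M. dist (y i) (y j) < e"
      by blast
  qed
  then obtain c where "y \<longlonglongrightarrow> c"
    using Cauchy_convergent convergent_def by blast
  then have "(\<lambda>n. f (y n)) \<longlonglongrightarrow> f c"
    by (intro continuous_on_tendsto_compose[OF cont]) auto
  with fy have fc: "f c = m"
    using LIMSEQ_unique by blast
  show thesis
  proof
    fix y assume "y \<noteq> c"
    then have "0 < (norm (c - y))\<^sup>2" by simp
    then have "0 < 2 * (f c - m) + 2 * (f y - m)"
      using close[of c y] by (rule less_le_trans)
    then show "f c < f y"
      by (simp add: fc)
  qed
qed

text \<open>
  This is the upper limit of \<open>\<parallel>x i - y\<parallel>\<close> along \<open>F\<close>. The infimum of eventual upper bounds keeps it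
  real-valued; it is meaningful when \<open>F\<close> is proper and \<open>x\<close> is eventually bounded. The filter \<open>F\<close>
  makes it possible to pass to a part of a sequence without reindexing.
\<close>

definition asymptotic_radius :: "'i filter \<Rightarrow> ('i \<Rightarrow> 'a::real_normed_vector) \<Rightarrow> 'a \<Rightarrow> real" where
  "asymptotic_radius F x y = Inf {r. \<forall>\<^sub>F i in F. norm (x i - y) \<le> r}"

definition asymptotic_centre :: "'i filter \<Rightarrow> ('i \<Rightarrow> 'a::real_normed_vector) \<Rightarrow> 'a \<Rightarrow> bool" where
  "asymptotic_centre F x c \<longleftrightarrow>
     (\<forall>y. y \<noteq> c \<longrightarrow> asymptotic_radius F x c < asymptotic_radius F x y)"

context
  fixes F :: "'i filter" and x :: "'i \<Rightarrow> 'a::real_normed_vector"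
  assumes nontrivial: "F \<noteq> bot"
begin

lemma eventually_bound_nonneg:
  "\<forall>\<^sub>F i in F. norm (x i - y) \<le> r \<Longrightarrow> 0 \<le> r"
  by (meson eventually_happens' nontrivial norm_ge_zero order_trans)

lemma asymptotic_radius_le:
  assumes "\<forall>\<^sub>F i in F. norm (x i - y) \<le> r"
  shows "asymptotic_radius F x y \<le> r"
  unfolding asymptotic_radius_def using assms eventually_bound_nonneg
  by (intro cInf_lower bdd_belowI[of _ 0]) auto

context
  fixes M :: real
  assumes bounded: "\<forall>\<^sub>F i in F. norm (x i) \<le> M"
begin

lemma eventually_bound_exists: "\<forall>\<^sub>F i in F. norm (x i - y) \<le> M + norm y"
  using bounded by eventually_elim (metis add_right_mono norm_triangle_ineq4 order_trans)

lemma eventually_le_of_asymptotic_radius_less: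
  assumes "asymptotic_radius F x y < r"
  shows "\<forall>\<^sub>F i in F. norm (x i - y) \<le> r"
proof -
  obtain r' where "\<forall>\<^sub>F i in F. norm (x i - y) \<le> r'" "r' < r"
    using cInf_lessD[OF _ assms[unfolded asymptotic_radius_def]] eventually_bound_exists
    by blast
  then show ?thesis
    by (auto elim: eventually_mono)
qed

lemma asymptotic_radius_nonneg: "0 \<le> asymptotic_radius F x y"
  unfolding asymptotic_radius_def using eventually_bound_exists eventually_bound_nonneg
  by (intro cInf_greatest) blast+

lemma asymptotic_radius_lipschitz:
  "asymptotic_radius F x y \<le> asymptotic_radius F x y' + norm (y - y')"
proof (rule field_le_epsilon)
  fix e :: real assume "0 < e"
  then have "\<forall>\<^sub>F i in F. norm (x i - y') \<le> asymptotic_radius F x y' + e"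
    by (intro eventually_le_of_asymptotic_radius_less) simp
  then have "\<forall>\<^sub>F i in F. norm (x i - y) \<le> asymptotic_radius F x y' + norm (y - y') + e"
  proof eventually_elim
    case (elim i)
    have "norm (x i - y) \<le> norm (x i - y') + norm (y - y')"
      by (metis norm_minus_commute dist_norm dist_triangle)
    with elim show ?case by simp
  qed
  then show "asymptotic_radius F x y \<le> asymptotic_radius F x y' + norm (y - y') + e"
    by (rule asymptotic_radius_le)
qed

lemma continuous_asymptotic_radius: "continuous_on UNIV (asymptotic_radius F x)"
proof (rule lipschitz_on_continuous_on)
  show "1-lipschitz_on UNIV (asymptotic_radius F x)"
  proof (rule lipschitz_onI)
    fix y y' :: 'a
    show "dist (asymptotic_radius F x y) (asymptotic_radius F x y') \<le> 1 * dist y y'"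
      using asymptotic_radius_lipschitz[of y y'] asymptotic_radius_lipschitz[of y' y]
      by (simp add: dist_norm norm_minus_commute abs_le_iff)
  qed simp
qed

text \<open>
  Squared radii are estimated through eventual bounds \<open>r\<close> slightly above the radius; letting \<open>r\<close> decrease
  to the radius gives the estimate itself.
\<close>

lemma asymptotic_radius_sq_le:
  assumes "\<And>r. asymptotic_radius F x y < r \<Longrightarrow> 0 < r \<Longrightarrow> s \<le> r\<^sup>2"
  shows "s \<le> (asymptotic_radius F x y)\<^sup>2"
proof (rule tendsto_lowerbound)
  let ?R = "asymptotic_radius F x y"
  show "((\<lambda>r. r\<^sup>2) \<longlongrightarrow> ?R\<^sup>2) (at_right ?R)"
    by (intro tendsto_intros)
  show "\<forall>\<^sub>F r in at_right ?R. s \<le> r\<^sup>2"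
    unfolding eventually_at_filter
    using assms asymptotic_radius_nonneg[of y] by (auto intro!: always_eventually)
qed simp

end

lemma asymptotic_radius_eq_limit:
  assumes "((\<lambda>i. norm (x i - y)) \<longlongrightarrow> l) F"
  shows "asymptotic_radius F x y = l"
proof (rule antisym)
  show "asymptotic_radius F x y \<le> l"
  proof (rule field_le_epsilon)
    fix e :: real assume "0 < e"
    then have "\<forall>\<^sub>F i in F. norm (x i - y) < l + e"
      using assms by (intro order_tendstoD) auto
    then show "asymptotic_radius F x y \<le> l + e"
      by (intro asymptotic_radius_le) (auto elim: eventually_mono)
  qed
  have "\<forall>\<^sub>F i in F. norm (x i - y) \<le> l + 1"
    using order_tendstoD(2)[OF assms, of "l + 1"] by (auto elim: eventually_mono)
  moreover have "l \<le> r" if "\<forall>\<^sub>F i in F. norm (x i - y) \<le> r" for r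
    using tendsto_upperbound[OF assms that nontrivial] .
  ultimately show "l \<le> asymptotic_radius F x y"
    unfolding asymptotic_radius_def by (intro cInf_greatest) blast+
qed

end

text \<open>
  Averaging the squared distances to \<open>y\<close> and \<open>y'\<close> for each \<open>x i\<close> by the parallelogram law shows that the
  squared radius is strongly midpoint convex.
\<close>

lemma asymptotic_centre_exists:
  fixes x :: "'i \<Rightarrow> 'a::{real_inner, complete_space}"
  assumes F: "F \<noteq> bot" and bounded: "\<forall>\<^sub>F i in F. norm (x i) \<le> M"
  obtains c where "asymptotic_centre F x c"
proof -
  let ?R = "asymptotic_radius F x"
  note R0 = asymptotic_radius_nonneg[OF F bounded]
  have "(?R ((1/2) *\<^sub>R (y + y')))\<^sup>2 \<le> ((?R y)\<^sup>2 + (?R y')\<^sup>2) / 2 - (norm (y - y'))\<^sup>2 / 4" for y y'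
  proof -
    let ?m = "(1/2) *\<^sub>R (y + y')"
    have main: "(?R ?m)\<^sup>2 \<le> (r\<^sup>2 + r'\<^sup>2) / 2 - (norm (y - y'))\<^sup>2 / 4"
      if r: "?R y < r" "0 < r" and r': "?R y' < r'" "0 < r'" for r r'
    proof -
      let ?q = "(r\<^sup>2 + r'\<^sup>2) / 2 - (norm (y - y'))\<^sup>2 / 4"
      have "\<forall>\<^sub>F i in F. norm (x i - ?m) \<le> sqrt ?q"
        using eventually_le_of_asymptotic_radius_less[OF F bounded r(1)]
          eventually_le_of_asymptotic_radius_less[OF F bounded r'(1)]
      proof eventually_elim
        case (elim i)
        have "x i - ?m = (1 - 1/2) *\<^sub>R (x i - y) + (1/2) *\<^sub>R (x i - y')"
          using scaleR_add_left[of "1/2" "1/2" "x i"] by (simp add: scaleR_diff_right scaleR_add_right)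
        then have "(norm (x i - ?m))\<^sup>2
            = ((norm (x i - y))\<^sup>2 + (norm (x i - y'))\<^sup>2) / 2 - (norm (y - y'))\<^sup>2 / 4"
          using norm_convex_comb_sq[of "1/2" "x i - y" "x i - y'"]
          by (simp add: norm_minus_commute field_simps)
        moreover have "(norm (x i - y))\<^sup>2 \<le> r\<^sup>2" "(norm (x i - y'))\<^sup>2 \<le> r'\<^sup>2"
          using elim by (auto intro!: power_mono)
        ultimately show ?case
          by (intro real_le_rsqrt) simp
      qed
      then have "?R ?m \<le> sqrt ?q" and "0 \<le> sqrt ?q"
        using asymptotic_radius_le[OF F] eventually_bound_nonneg[OF F] by blast+
      then have "(?R ?m)\<^sup>2 \<le> (sqrt ?q)\<^sup>2" "0 \<le> ?q"
        using R0 by (blast intro: power_mono, simp only: real_sqrt_ge_0_iff)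
      then show ?thesis by simp
    qed
    \<comment> \<open>The two bounds are sent to their radii one after the other.\<close>
    have "2 * ((?R ?m)\<^sup>2 + (norm (y - y'))\<^sup>2 / 4) - r'\<^sup>2 \<le> (?R y)\<^sup>2"
      if "?R y' < r'" "0 < r'" for r'
      by (rule asymptotic_radius_sq_le[OF F bounded])
        (use main that in \<open>fastforce simp: field_simps\<close>)
    then have "2 * ((?R ?m)\<^sup>2 + (norm (y - y'))\<^sup>2 / 4) - (?R y)\<^sup>2 \<le> (?R y')\<^sup>2"
      by (intro asymptotic_radius_sq_le[OF F bounded]) (fastforce simp: field_simps)
    then show ?thesis by (simp add: field_simps)
  qed
  moreover have "continuous_on UNIV (\<lambda>y. (?R y)\<^sup>2)"
    by (intro continuous_intros continuous_asymptotic_radius[OF F bounded])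
  ultimately obtain c where "\<And>y. y \<noteq> c \<Longrightarrow> (?R c)\<^sup>2 < (?R y)\<^sup>2"
    using strongly_midconvex_has_strict_minimum[of "\<lambda>y. (?R y)\<^sup>2"] by (metis zero_le_power2)
  then have "asymptotic_centre F x c"
    unfolding asymptotic_centre_def using R0 power_less_imp_less_base by blast
  then show thesis by (rule that)
qed

section \<open>From asymptotic centres to fixed points and weak limits\<close>

text \<open>
  Since \<open>\<parallel>x i - T c\<parallel> \<le> \<parallel>x i - T (x i)\<parallel> + \<parallel>x i - c\<parallel>\<close>, the radius about \<open>T c\<close> is at most that about \<open>c\<close>,
  and the minimiser is unique.
\<close>

lemma asymptotic_centre_is_fixed_point:
  fixes x :: "'i \<Rightarrow> 'a::real_normed_vector"
  assumes F: "F \<noteq> bot" and bounded: "\<forall>\<^sub>F i in F. norm (x i) \<le> M"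
    and T: "1-lipschitz_on UNIV T"
    and approx: "((\<lambda>i. x i - T (x i)) \<longlongrightarrow> 0) F"
    and c: "asymptotic_centre F x c"
  shows "c \<in> fixed_points T"
proof -
  have "asymptotic_radius F x (T c) \<le> asymptotic_radius F x c"
  proof (rule field_le_epsilon)
    fix e :: real assume "0 < e"
    then have "\<forall>\<^sub>F i in F. norm (x i - c) \<le> asymptotic_radius F x c + e / 2"
      by (intro eventually_le_of_asymptotic_radius_less[OF F bounded]) simp
    moreover have "\<forall>\<^sub>F i in F. norm (x i - T (x i)) < e / 2"
      using tendstoD[OF approx, of "e / 2"] \<open>0 < e\<close> by simp
    ultimately have "\<forall>\<^sub>F i in F. norm (x i - T c) \<le> asymptotic_radius F x c + e"
    proof eventually_elim
      case (elim i)
      have "norm (T (x i) - T c) \<le> norm (x i - c)"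
        using lipschitz_onD[OF T, of "x i" c] by (simp add: dist_norm)
      moreover have "norm (x i - T c) \<le> norm (x i - T (x i)) + norm (T (x i) - T c)"
        by (metis dist_norm dist_triangle)
      ultimately show ?case
        using elim by simp
    qed
    then show "asymptotic_radius F x (T c) \<le> asymptotic_radius F x c + e"
      by (rule asymptotic_radius_le[OF F])
  qed
  with c have "T c = c"
    unfolding asymptotic_centre_def by (metis linorder_not_less)
  then show ?thesis
    by (simp add: fixed_points_def)
qed

text \<open>
  Replacing \<open>c\<close> by \<open>c + t u\<close> changes the squared distance to a point beyond the hyperplane by at most
  \<open>- 2 t \<delta> + t\<^sup>2 \<parallel>u\<parallel>\<^sup>2\<close>, which is negative for small \<open>t > 0\<close>; so \<open>c\<close> would not minimise the radius.
\<close>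

lemma asymptotic_centre_not_separated:
  fixes x :: "'i \<Rightarrow> 'a::real_inner"
  assumes F: "F \<noteq> bot" and bounded: "\<forall>\<^sub>F i in F. norm (x i) \<le> M"
    and c: "asymptotic_centre F x c"
    and "0 < \<delta>"
  shows "\<not> (\<forall>\<^sub>F i in F. \<delta> \<le> (x i - c) \<bullet> u)"
proof
  assume sep: "\<forall>\<^sub>F i in F. \<delta> \<le> (x i - c) \<bullet> u"
  then have "u \<noteq> 0"
    using F \<open>0 < \<delta>\<close> by (auto dest: eventually_happens')
  \<comment> \<open>This step minimises \<open>- 2 t \<delta> + t\<^sup>2 \<parallel>u\<parallel>\<^sup>2\<close>; the minimum is \<open>- t \<delta>\<close>.\<close>
  define t where "t = \<delta> / (norm u)\<^sup>2"
  have "0 < t"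
    using \<open>u \<noteq> 0\<close> \<open>0 < \<delta>\<close> by (simp add: t_def)
  have tu: "t * (norm u)\<^sup>2 = \<delta>"
    using \<open>u \<noteq> 0\<close> by (simp add: t_def)
  let ?R = "asymptotic_radius F x c" and ?R' = "asymptotic_radius F x (c + t *\<^sub>R u)"
  have R0: "0 \<le> ?R" "0 \<le> ?R'"
    using asymptotic_radius_nonneg[OF F bounded] by auto
  have "?R'\<^sup>2 + t * \<delta> \<le> ?R\<^sup>2"
  proof (rule asymptotic_radius_sq_le[OF F bounded])
    fix r assume r: "?R < r" "0 < r"
    have "\<forall>\<^sub>F i in F. norm (x i - (c + t *\<^sub>R u)) \<le> sqrt (r\<^sup>2 - t * \<delta>)"
      using sep eventually_le_of_asymptotic_radius_less[OF F bounded r(1)]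
    proof eventually_elim
      case (elim i)
      have "(norm (x i - (c + t *\<^sub>R u)))\<^sup>2
          = (norm (x i - c))\<^sup>2 - 2 * t * ((x i - c) \<bullet> u) + t * (t * (norm u)\<^sup>2)"
        using norm_diff_scaleR_sq[of "x i - c" t u] by (simp add: diff_diff_eq)
      moreover have "(norm (x i - c))\<^sup>2 \<le> r\<^sup>2"
        using elim by (auto intro!: power_mono)
      moreover have "t * \<delta> \<le> t * ((x i - c) \<bullet> u)"
        using elim \<open>0 < t\<close> by simp
      ultimately show ?case
        unfolding tu by (intro real_le_rsqrt) linarith
    qed
    then have "?R' \<le> sqrt (r\<^sup>2 - t * \<delta>)" "0 \<le> sqrt (r\<^sup>2 - t * \<delta>)"
      using asymptotic_radius_le[OF F] eventually_bound_nonneg[OF F] by blast+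
    then have "?R'\<^sup>2 \<le> (sqrt (r\<^sup>2 - t * \<delta>))\<^sup>2" "0 \<le> r\<^sup>2 - t * \<delta>"
      using R0 by (blast intro: power_mono, simp only: real_sqrt_ge_0_iff)
    then show "?R'\<^sup>2 + t * \<delta> \<le> r\<^sup>2" by simp
  qed
  then have "?R'\<^sup>2 < ?R\<^sup>2"
    using \<open>0 < t\<close> \<open>0 < \<delta>\<close> by (smt (verit) mult_pos_pos)
  then have "?R' < ?R"
    using R0 power_less_imp_less_base by blast
  moreover have "c + t *\<^sub>R u \<noteq> c"
    using \<open>0 < t\<close> \<open>u \<noteq> 0\<close> by simp
  ultimately show False
    using c unfolding asymptotic_centre_def by (metis less_asym)
qed

text \<open>
  Convergence of the distances to fixed points makes the centre independent of the part of the sequence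
  that is considered. If \<open>x\<close> did not converge weakly to the common centre, it would be separated from
  the centre along a finer filter.
\<close>

lemma weakly_converges_to_fixed_point:
  fixes x :: "nat \<Rightarrow> 'a::{real_inner, complete_space}"
  assumes T: "1-lipschitz_on UNIV T"
    and bounded: "\<And>k. norm (x k) \<le> M"
    and approx: "(\<lambda>k. x k - T (x k)) \<longlonglongrightarrow> 0"
    and conv: "\<And>y. y \<in> fixed_points T \<Longrightarrow> convergent (\<lambda>k. norm (x k - y))"
  shows "\<exists>c \<in> fixed_points T. weakly_converges_to x c"
proof -
  have bdd: "\<forall>\<^sub>F k in F. norm (x k) \<le> M" for F
    using bounded by simp
  obtain c where c: "asymptotic_centre sequentially x c"
    using asymptotic_centre_exists[OF sequentially_bot bdd] .
  have fix_centre: "c' \<in> fixed_points T"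
    if "F \<noteq> bot" "F \<le> sequentially" "asymptotic_centre F x c'" for F c'
    using asymptotic_centre_is_fixed_point[OF that(1) bdd T tendsto_mono[OF that(2) approx] that(3)] .
  have radius_eq: "asymptotic_radius F x y = asymptotic_radius sequentially x y"
    if "F \<noteq> bot" "F \<le> sequentially" "y \<in> fixed_points T" for F y
    using conv[OF that(3)] asymptotic_radius_eq_limit that(1,2) sequentially_bot tendsto_mono
    unfolding convergent_def by metis
  have cT: "c \<in> fixed_points T"
    using fix_centre[OF sequentially_bot order_refl c] .
  have centre: "asymptotic_centre F x c" if F: "F \<noteq> bot" "F \<le> sequentially" for F
  proof -
    obtain c' where c': "asymptotic_centre F x c'"
      using asymptotic_centre_exists[OF F(1) bdd] .
    have "c' = c"
    proof (rule ccontr)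
      assume "c' \<noteq> c"
      then have "asymptotic_radius F x c' < asymptotic_radius F x c"
        "asymptotic_radius sequentially x c < asymptotic_radius sequentially x c'"
        using c c' unfolding asymptotic_centre_def by auto
      then show False
        using radius_eq[OF F cT] radius_eq[OF F fix_centre[OF F c']] by simp
    qed
    with c' show ?thesis by simp
  qed
  have below: "\<forall>\<^sub>F k in sequentially. (x k - c) \<bullet> u < \<delta>" if "0 < \<delta>" for u \<delta>
  proof (rule ccontr)
    assume *: "\<not> ?thesis"
    \<comment> \<open>The filter of the subsequence of indices that violate the bound.\<close>
    let ?F = "inf sequentially (principal {k. \<delta> \<le> (x k - c) \<bullet> u})"
    have "?F \<noteq> bot"
      using * by (simp add: trivial_limit_def eventually_inf_principal not_le)
    moreover have "\<forall>\<^sub>F k in ?F. \<delta> \<le> (x k - c) \<bullet> u"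
      by (simp add: eventually_inf_principal)
    ultimately show False
      using asymptotic_centre_not_separated[OF _ bdd centre that] by (metis inf_le1)
  qed
  have "(\<lambda>k. x k \<bullet> u) \<longlonglongrightarrow> c \<bullet> u" for u
  proof (rule tendstoI)
    fix \<delta> :: real assume "0 < \<delta>"
    from below[OF this, of u] below[OF this, of "- u"]
    show "\<forall>\<^sub>F k in sequentially. dist (x k \<bullet> u) (c \<bullet> u) < \<delta>"
      by eventually_elim (simp add: dist_real_def inner_diff_left abs_less_iff)
  qed
  with cT show ?thesis
    unfolding weakly_converges_to_def by blast
qed

section \<open>The non-stationary iteration\<close>

lemma summable_deviation:
  fixes S :: "nat \<Rightarrow> 'a::real_normed_vector \<Rightarrow> 'a"
  assumes fin: "(\<Sum>k. ennreal (lam k) * ball_deviation (S k) T \<rho>) < \<infinity>"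
    and lam: "\<And>k. 0 \<le> lam k" and y: "\<And>k. norm (y k) \<le> \<rho>"
  shows "summable (\<lambda>k. lam k * norm (S k (y k) - T (y k)))"
proof (rule summable_suminf_not_top)
  have "ennreal (lam k * norm (S k (y k) - T (y k)))
      \<le> ennreal (lam k) * ball_deviation (S k) T \<rho>" for k
    unfolding ball_deviation_def using lam y
    by (auto simp: ennreal_mult intro!: mult_left_mono SUP_upper)
  then have "(\<Sum>k. ennreal (lam k * norm (S k (y k) - T (y k))))
      \<le> (\<Sum>k. ennreal (lam k) * ball_deviation (S k) T \<rho>)"
    by (intro suminf_le) auto
  with fin show "(\<Sum>k. ennreal (lam k * norm (S k (y k) - T (y k)))) \<noteq> top"
    by (auto simp: top_unique)
qed (use lam in auto)

text \<open>
  The relaxed point is a convex combination of \<open>z\<close> and \<open>T z\<close>, neither of which is farther from \<open>p\<close>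
  than \<open>z\<close>; uniform convexity of the norm supplies the gain.
\<close>

lemma relaxed_step_decrease:
  fixes T :: "'a::real_inner \<Rightarrow> 'a"
  assumes T: "1-lipschitz_on UNIV T" and p: "p \<in> fixed_points T" and l: "0 \<le> l"
  shows "(norm (relaxed_op l T z - p))\<^sup>2 + l * (1 - l) * (norm (z - T z))\<^sup>2 \<le> (norm (z - p))\<^sup>2"
proof -
  have "norm (T z - p) \<le> norm (z - p)"
    using lipschitz_onD[OF T, of z p] p by (simp add: dist_norm fixed_points_def)
  then have "l * (norm (T z - p))\<^sup>2 \<le> l * (norm (z - p))\<^sup>2"
    using l by (intro mult_left_mono power_mono) auto
  moreover have "relaxed_op l T z - p = (1 - l) *\<^sub>R (z - p) + l *\<^sub>R (T z - p)"
    by (simp add: relaxed_op_def algebra_simps)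
  ultimately show ?thesis
    using norm_convex_comb_sq[of l "z - p" "T z - p"] by (simp add: left_diff_distrib)
qed

theorem theorem4:
  fixes T :: "'a::{real_inner, complete_space} \<Rightarrow> 'a"
    and Tk :: "nat \<Rightarrow> 'a \<Rightarrow> 'a"
    and lam \<beta> :: "nat \<Rightarrow> real"
    and \<epsilon> z \<pi> e :: "nat \<Rightarrow> 'a"
  assumes nonexpansive: "1-lipschitz_on UNIV T"
    and iter: "\<And>k. z (Suc k) = z k + lam k *\<^sub>R (Tk k (z k) + \<epsilon> k - z k)"
    and pi_def: "\<And>k. \<pi> k = (Tk k (z k) - T (z k)) + \<epsilon> k"
    and e_def: "\<And>k. e k = (z k - z (Suc k)) /\<^sub>R lam k + \<pi> k"
    and A1: "fixed_points T \<noteq> {}"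
    and A2_lipschitz: "\<And>k. (1 + \<beta> k)-lipschitz_on UNIV (relaxed_op (lam k) (Tk k))"
    and A2_nonneg: "\<And>k. \<beta> k \<ge> 0"
    and A2_summable: "summable \<beta>"
    and A3_range: "\<And>k. lam k \<in> {0<..<1}"
    and A3_inf: "(INF k. lam k * (1 - lam k)) > 0"
    and A4: "summable (\<lambda>k. lam k * norm (\<epsilon> k))"
    and A5: "\<And>\<rho>. \<rho> \<ge> 0 \<Longrightarrow> (\<Sum>k. ennreal (lam k) * ball_deviation (Tk k) T \<rho>) < \<infinity>"
  shows "e \<longlonglongrightarrow> 0 \<and> (\<exists>zs \<in> fixed_points T. weakly_converges_to z zs)"
proof -
  have lam: "0 < lam k" "lam k < 1" for k
    using A3_range[of k] by auto
  define m where "m = (INF k. lam k * (1 - lam k))"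
  have "0 < m"
    using A3_inf by (simp add: m_def)
  have m_le: "m \<le> lam k * (1 - lam k)" for k
    unfolding m_def
  proof (rule cINF_lower)
    show "bdd_below (range (\<lambda>k. lam k * (1 - lam k)))"
      using lam by (intro bdd_belowI[of _ 0]) (auto intro: mult_nonneg_nonneg less_imp_le)
  qed simp
  have step_Tk: "z (Suc k) = relaxed_op (lam k) (Tk k) (z k) + lam k *\<^sub>R \<epsilon> k" for k
    by (simp add: iter relaxed_op_def algebra_simps)
  have step_T: "z (Suc k) = relaxed_op (lam k) T (z k) + lam k *\<^sub>R \<pi> k" for k
    by (simp add: iter pi_def relaxed_op_def algebra_simps)
  have e_eq: "e k = z k - T (z k)" for k
    using lam[of k] by (simp add: e_def iter pi_def algebra_simps)
  obtain p where p: "p \<in> fixed_points T"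
    using A1 by blast

  \<comment> \<open>Before the iterates are known to stay in a ball, the deviation is controlled only at points
    fixed in advance, such as \<open>p\<close>.\<close>
  have sum_dev_p: "summable (\<lambda>k. lam k * norm (Tk k p - T p))"
    using summable_deviation[OF A5 lam(1)[THEN less_imp_le], of "norm p" "\<lambda>_. p"] by simp
  have step_bound: "norm (z (Suc k) - p) \<le> (1 + \<beta> k) * norm (z k - p)
      + (lam k * norm (Tk k p - T p) + lam k * norm (\<epsilon> k))" for k
  proof -
    let ?R = "relaxed_op (lam k) (Tk k)"
    have "?R p - p = lam k *\<^sub>R (Tk k p - T p)"
      using p by (simp add: relaxed_op_def fixed_points_def algebra_simps)
    then have "norm (?R p - p) = lam k * norm (Tk k p - T p)"
      using lam[of k] by simp
    moreover have "norm (?R (z k) - ?R p) \<le> (1 + \<beta> k) * norm (z k - p)"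
      using lipschitz_onD[OF A2_lipschitz, of "z k" p] by (simp add: dist_norm)
    moreover have "norm (lam k *\<^sub>R \<epsilon> k) = lam k * norm (\<epsilon> k)"
      using lam[of k] by simp
    moreover have "z (Suc k) - p = (?R (z k) - ?R p) + ((?R p - p) + lam k *\<^sub>R \<epsilon> k)"
      by (simp add: step_Tk)
    ultimately show ?thesis
      by (smt (verit) norm_triangle_ineq)
  qed
  obtain B where B: "\<And>k. norm (z k - p) \<le> B"
  proof (rule perturbed_contraction_bounded[OF step_bound _ A2_nonneg _ A2_summable
        summable_add[OF sum_dev_p A4]])
    show "0 \<le> lam k * norm (Tk k p - T p) + lam k * norm (\<epsilon> k)" for k
      using lam(1)[of k] by simp
  qed auto
  define \<rho> where "\<rho> = B + norm p"
  have z_bound: "norm (z k) \<le> \<rho>" for k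
    using B[of k] norm_triangle_sub[of "z k" p] by (simp add: \<rho>_def)
  then have "0 \<le> \<rho>"
    by (meson norm_ge_zero order_trans)

  \<comment> \<open>With the iterates in a ball, the size \<open>s\<close> of the perturbation of the \<open>T\<close>-step is summable.\<close>
  define s where "s k = lam k * norm (\<pi> k)" for k
  have s0: "0 \<le> s k" for k
    using lam[of k] by (simp add: s_def)
  have s_summable: "summable s"
  proof (rule summable_comparison_test')
    show "summable (\<lambda>k. lam k * norm (Tk k (z k) - T (z k)) + lam k * norm (\<epsilon> k))"
      by (rule summable_add[OF summable_deviation[OF A5 lam(1)[THEN less_imp_le] z_bound] A4])
        (rule \<open>0 \<le> \<rho>\<close>)
    fix k
    have "s k \<le> lam k * (norm (Tk k (z k) - T (z k)) + norm (\<epsilon> k))"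
      unfolding s_def pi_def using lam[of k] by (intro mult_left_mono norm_triangle_ineq) auto
    with s0[of k] show "norm (s k) \<le> lam k * norm (Tk k (z k) - T (z k)) + lam k * norm (\<epsilon> k)"
      by (simp add: distrib_left)
  qed
  have near: "norm (z (Suc k) - q) \<le> norm (relaxed_op (lam k) T (z k) - q) + s k" for k q
  proof -
    have "z (Suc k) - q = (relaxed_op (lam k) T (z k) - q) + lam k *\<^sub>R \<pi> k"
      by (simp add: step_T)
    then have "norm (z (Suc k) - q)
        \<le> norm (relaxed_op (lam k) T (z k) - q) + norm (lam k *\<^sub>R \<pi> k)"
      by (simp only: norm_triangle_ineq)
    then show ?thesis
      using lam[of k] by (simp add: s_def)
  qed
  have decrease: "(norm (relaxed_op (lam k) T (z k) - q))\<^sup>2 + m * (norm (e k))\<^sup>2 \<le> (norm (z k - q))\<^sup>2"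
    if "q \<in> fixed_points T" for k q
    using relaxed_step_decrease[OF nonexpansive that, of "lam k" "z k"] lam(1)[of k]
      mult_right_mono[OF m_le[of k], of "(norm (e k))\<^sup>2"] by (simp add: e_eq)
  have relaxed_le: "norm (relaxed_op (lam k) T (z k) - q) \<le> norm (z k - q)"
    if "q \<in> fixed_points T" for k q
  proof (rule power2_le_imp_le)
    have "0 \<le> m * (norm (e k))\<^sup>2"
      using \<open>0 < m\<close> by simp
    then show "(norm (relaxed_op (lam k) T (z k) - q))\<^sup>2 \<le> (norm (z k - q))\<^sup>2"
      using decrease[OF that, of k] by linarith
  qed simp
  have fejer: "convergent (\<lambda>k. norm (z k - q))" if "q \<in> fixed_points T" for q
  proof (rule summably_increasing_convergent[OF _ _ s0 s_summable])
    show "norm (z (Suc k) - q) \<le> norm (z k - q) + s k" for k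
      using near[of k q] relaxed_le[OF that, of k] by linarith
  qed simp

  \<comment> \<open>Squaring the perturbed step costs the cross term \<open>2 B s\<close> and \<open>s\<^sup>2\<close>; both are bounded
    by a constant multiple of \<open>s\<close>.\<close>
  have "summable (\<lambda>k. m * (norm (e k))\<^sup>2)"
  proof (rule summable_of_decrease[where A = "\<lambda>k. (norm (z k - p))\<^sup>2"])
    show "summable (\<lambda>k. (2 * B + suminf s) * s k)"
      using s_summable by (rule summable_mult)
    have "0 \<le> B"
      using B[of 0] norm_ge_zero order_trans by blast
    have "s k \<le> suminf s" for k
      using sum_le_suminf[OF s_summable, of "{k}"] s0 by simp
    then show "0 \<le> (2 * B + suminf s) * s k" for k
      using \<open>0 \<le> B\<close> s0 by (metis add_nonneg_nonneg mult_nonneg_nonneg order_trans zero_le_numeral)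
    show "(norm (z (Suc k) - p))\<^sup>2 + m * (norm (e k))\<^sup>2
        \<le> (norm (z k - p))\<^sup>2 + (2 * B + suminf s) * s k" for k
    proof -
      let ?w = "norm (relaxed_op (lam k) T (z k) - p)"
      have "(norm (z (Suc k) - p))\<^sup>2 \<le> (?w + s k)\<^sup>2"
        using near[of k p] by (intro power_mono) auto
      also have "\<dots> = ?w\<^sup>2 + (2 * ?w + s k) * s k"
        by (simp add: power2_eq_square algebra_simps)
      also have "(2 * ?w + s k) * s k \<le> (2 * B + suminf s) * s k"
        using relaxed_le[OF p, of k] B[of k] \<open>s k \<le> suminf s\<close> s0[of k]
        by (intro mult_right_mono) auto
      finally show ?thesis
        using decrease[OF p, of k] by linarith
    qed
  qed (use \<open>0 < m\<close> in auto)
  then have "summable (\<lambda>k. (norm (e k))\<^sup>2)"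
    using \<open>0 < m\<close> by (simp add: summable_cmult_iff)
  then have "(\<lambda>k. sqrt ((norm (e k))\<^sup>2)) \<longlonglongrightarrow> sqrt 0"
    by (intro tendsto_real_sqrt summable_LIMSEQ_zero)
  then have "e \<longlonglongrightarrow> 0"
    by (simp add: tendsto_norm_zero_iff)
  moreover from this have "(\<lambda>k. z k - T (z k)) \<longlonglongrightarrow> 0"
    by (simp flip: e_eq)
  then have "\<exists>zs \<in> fixed_points T. weakly_converges_to z zs"
    by (intro weakly_converges_to_fixed_point[OF nonexpansive z_bound _ fejer])
  ultimately show ?thesis
    by blast
qed

end
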